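(* Let $n\ge1$, $d\in\{0,1,\dots,n\}$, $D=\sum_{k=0}^d\binom nk$, and $\varepsilon,\delta\in(0,1)$. The noiseless sample complexity of approximate $L_\infty$ recovery of $\mathcal P_{n,d}$ with error $\varepsilon$ by deterministic adaptive algorithms is exactly $D$. Moreover, if $0<2\delta+\varepsilon<1/30$, then the noiseless sample complexity for adaptive randomized algorithms satisfies $D/2\le m^{(0)}(\mathcal P_{n,d},\varepsilon,\delta)\le D$.
   Context: For $S\subseteq[n]$ let $\chi_S(x)=\prod_{i\in S}x_i$ on $\{-1,1\}^n$ ($\chi_\emptyset=1$), and $\|f\|_{L_\infty}=\max_{x\in\{-1,1\}^n}|f(x)|$. $\mathcal P_{n,d}$ is the set of $f=\sum_{|S|\le d}\theta_S\chi_S$ with real coefficients and $\|f\|_{L_\infty}\le1$. Noiseless adaptive query model: at each round $t=1,\dots,m$ the learner picks $X_t\in\{-1,1\}^n$, possibly depending on $(X_1,f(X_1)),\dots,(X_{t-1},f(X_{t-1}))$ (and, if randomized, on internal randomness), and observes the exact value $f(X_t)$. It then outputs $\widehat f:\{-1,1\}^n\to\mathbb R$. $m^{(0)}(\mathcal F,\varepsilon,\delta)$ is the infimum of the integers $m\ge0$ for which some (possibly randomized) adaptive $m$-query learner satisfies $\mathbb P_f(\|f-\widehat f\|_{L_\infty}>\varepsilon)\le\delta$ for every $f\in\mathcal F$. For deterministic algorithms, the sample complexity is the least $m$ for which some deterministic adaptive $m$-query learner satisfies $\|f-\widehat f\|_{L_\infty}\le\varepsilon$ for every $f\in\mathcal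 F$ (with no randomness, the probability requirement reduces to this). *)

theory Defs
  imports "HOL-Probability.Probability"
begin

definition cube :: "nat \<Rightarrow> (nat \<Rightarrow> real) set" where
  "cube n = {1..n} \<rightarrow>\<^sub>E {-1, 1}"

definition chi :: "nat set \<Rightarrow> (nat \<Rightarrow> real) \<Rightarrow> real" where
  "chi S x = (\<Prod>i\<in>S. x i)"

definition Linf_norm :: "nat \<Rightarrow> ((nat \<Rightarrow> real) \<Rightarrow> real) \<Rightarrow> real" where
  "Linf_norm n f = Max ((\<lambda>x. \<bar>f x\<bar>) ` cube n)"

text \<open>Functions on the cube are total functions on \<open>nat \<Rightarrow> real\<close> of which only the values on
  \<open>cube n\<close> are ever used.\<close>

definition bounded_polys :: "nat \<Rightarrow> nat \<Rightarrow> ((nat \<Rightarrow> real) \<Rightarrow> real) set" where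
  "bounded_polys n d =
     {f. (\<exists>\<theta>. \<forall>x\<in>cube n. f x = (\<Sum>S | S \<subseteq> {1..n} \<and> card S \<le> d. \<theta> S * chi S x))
         \<and> Linf_norm n f \<le> 1}"

text \<open>A history of \<open>t\<close> rounds maps each round \<open>i < t\<close> (rounds are numbered from 0) to the pair of
  query point and observed value, and is \<open>undefined\<close> elsewhere.\<close>

type_synonym history = "nat \<Rightarrow> (nat \<Rightarrow> real) \<times> real"

definition history_space :: "nat \<Rightarrow> nat \<Rightarrow> history measure" where
  "history_space n t = (\<Pi>\<^sub>M i\<in>{..<t}. count_space (cube n) \<Otimes>\<^sub>M borel)"

primrec transcript ::
  "(nat \<Rightarrow> history \<Rightarrow> (nat \<Rightarrow> real)) \<Rightarrow> ((nat \<Rightarrow> real) \<Rightarrow> real) \<Rightarrow> nat \<Rightarrow> history" where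
  "transcript q f 0 = (\<lambda>_. undefined)"
| "transcript q f (Suc t) =
     (let h = transcript q f t; x = q t h in h(t := (x, f x)))"

text \<open>A learner consists of query rules \<open>q t\<close>, applied to histories of \<open>t\<close> rounds, and an output
  rule \<open>out\<close>, applied to the final history. No measurability is imposed on deterministic
  learners.\<close>

definition det_learner :: "nat \<Rightarrow> nat \<Rightarrow> (nat \<Rightarrow> history \<Rightarrow> (nat \<Rightarrow> real)) \<Rightarrow> bool" where
  "det_learner n m q \<longleftrightarrow> (\<forall>t<m. \<forall>h\<in>space (history_space n t). q t h \<in> cube n)"

definition det_recovers ::
  "nat \<Rightarrow> ((nat \<Rightarrow> real) \<Rightarrow> real) set \<Rightarrow> real \<Rightarrow> nat \<Rightarrow> bool" where
  "det_recovers n F \<epsilon> m \<longleftrightarrow>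
     (\<exists>q (out :: history \<Rightarrow> (nat \<Rightarrow> real) \<Rightarrow> real). det_learner n m q \<and>
        (\<forall>f\<in>F. Linf_norm n (\<lambda>x. f x - out (transcript q f m) x) \<le> \<epsilon>))"

text \<open>The infimum is taken in \<open>enat\<close>, so that it is \<open>\<infinity>\<close> if no number of queries suffices.\<close>

definition det_complexity :: "nat \<Rightarrow> ((nat \<Rightarrow> real) \<Rightarrow> real) set \<Rightarrow> real \<Rightarrow> enat" where
  "det_complexity n F \<epsilon> = Inf (enat ` {m. det_recovers n F \<epsilon> m})"

text \<open>For a randomized learner all internal randomness is a single sample \<open>\<omega>\<close> of a probability
  space \<open>M\<close>. The rules are measurable jointly in \<open>\<omega>\<close> and the history; measurability of the
  failure events for each single \<open>f\<close> would not be enough, since non-measurable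
  encodings of the observed reals would then be admissible.\<close>

definition rand_learner ::
  "'w measure \<Rightarrow> nat \<Rightarrow> nat \<Rightarrow> ('w \<Rightarrow> nat \<Rightarrow> history \<Rightarrow> (nat \<Rightarrow> real)) \<Rightarrow>
     ('w \<Rightarrow> history \<Rightarrow> (nat \<Rightarrow> real) \<Rightarrow> real) \<Rightarrow> bool" where
  "rand_learner M n m q out \<longleftrightarrow> prob_space M \<and>
     (\<forall>t<m. (\<lambda>(\<omega>, h). q \<omega> t h) \<in> M \<Otimes>\<^sub>M history_space n t \<rightarrow>\<^sub>M count_space (cube n)) \<and>
     (\<forall>x\<in>cube n. (\<lambda>(\<omega>, h). out \<omega> h x) \<in> borel_measurable (M \<Otimes>\<^sub>M history_space n m))"

definition rand_recovers ::
  "'w itself \<Rightarrow> nat \<Rightarrow> ((nat \<Rightarrow> real) \<Rightarrow> real) set \<Rightarrow> real \<Rightarrow> real \<Rightarrow> nat \<Rightarrow> bool" where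
  "rand_recovers _ n F \<epsilon> \<delta> m \<longleftrightarrow>
     (\<exists>(M :: 'w measure) q out. rand_learner M n m q out \<and>
        (\<forall>f\<in>F. measure M {\<omega> \<in> space M.
            Linf_norm n (\<lambda>x. f x - out \<omega> (transcript (q \<omega>) f m) x) > \<epsilon>} \<le> \<delta>))"

text \<open>HOL cannot quantify over the type of outcomes inside a definition, so \<open>'w\<close> is a parameter
  of the complexity; results are to be stated for arbitrary \<open>'w\<close>.\<close>

definition rand_complexity ::
  "'w itself \<Rightarrow> nat \<Rightarrow> ((nat \<Rightarrow> real) \<Rightarrow> real) set \<Rightarrow> real \<Rightarrow> real \<Rightarrow> enat" where
  "rand_complexity W n F \<epsilon> \<delta> = Inf (enat ` {m. rand_recovers W n F \<epsilon> \<delta> m})"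

end

theory Submission imports Defs begin

text \<open>Let \<open>D\<close> be the dimension of the space of polynomials of degree at most \<open>d\<close>.
  For the upper bounds, \<open>D\<close> suitable points determine a polynomial, linearly in its values.

  For the lower bounds, consider polynomials with integer coefficients. Those that vanish at \<open>m\<close>
  given points form a lattice with at least \<open>k ^ (D - m)\<close> residue classes modulo \<open>k\<close>. If \<open>m < D\<close>,
  it contains some \<open>g \<noteq> 0\<close>, and normalized \<open>g\<close> and \<open>-g\<close> look like \<open>0\<close> to a deterministic learner.

  A randomized learner with \<open>2 * m < D\<close> is tested on the uniform distribution over the integer
  polynomials of norm at most \<open>R\<close>, divided by \<open>R\<close>. For each fixed value of the randomness, the
  successes with a given transcript differ by lattice vectors of norm at most \<open>2 * \<epsilon> * R\<close>. After
  stretching these differences by \<open>9\<close> there is room for \<open>9 ^ (D - m)\<close> distinct residues around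
  every success, still within norm \<open>2 * R\<close> as \<open>\<epsilon> < 1 / 30\<close>, and doubling the norm multiplies the
  number of polynomials by at most \<open>3 ^ D\<close>. As \<open>3 * 3 ^ D \<le> 9 ^ (D - m)\<close>, at most one third of the
  polynomials are successes.\<close>

section \<open>The cube and its characters\<close>

lemma finite_cube [simp]: "finite (cube n)"
  unfolding cube_def by (intro finite_PiE) auto

lemma cube_nonempty [simp]: "cube n \<noteq> {}"
  unfolding cube_def by (simp add: PiE_eq_empty_iff)

lemma Linf_norm_le_iff: "Linf_norm n f \<le> c \<longleftrightarrow> (\<forall>x\<in>cube n. \<bar>f x\<bar> \<le> c)"
  unfolding Linf_norm_def by (subst Max_le_iff) auto

definition low_sets :: "nat \<Rightarrow> nat \<Rightarrow> nat set set" where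
  "low_sets n d = {S. S \<subseteq> {1..n} \<and> card S \<le> d}"

lemma finite_low_sets [simp]: "finite (low_sets n d)"
  unfolding low_sets_def by (rule finite_subset[of _ "Pow {1..n}"]) auto

lemma card_low_sets: "card (low_sets n d) = (\<Sum>k=0..d. n choose k)"
proof -
  have "low_sets n d = (\<Union>k\<in>{0..d}. {S. S \<subseteq> {1..n} \<and> card S = k})"
    by (auto simp: low_sets_def)
  also have "card \<dots> = (\<Sum>k\<in>{0..d}. card {S. S \<subseteq> {1..n} \<and> card S = k})"
    by (intro card_UN_disjoint) auto
  finally show ?thesis by (simp add: n_subsets)
qed

lemma chi_eq_prod:
  assumes "S \<subseteq> {1..n}"
  shows "chi S x = (\<Prod>i\<in>{1..n}. if i \<in> S then x i else 1)"
  unfolding chi_def using assms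
  by (subst prod.inter_restrict[symmetric]) (auto simp: Int_absorb1)

lemma chi_cases:
  assumes "S \<subseteq> {1..n}" "x \<in> cube n"
  shows "chi S x = 1 \<or> chi S x = -1"
proof -
  have "finite S" using assms(1) by (rule finite_subset) simp
  then show ?thesis using assms(1)
  proof (induction S rule: finite_induct)
    case (insert i S)
    then have "x i = 1 \<or> x i = -1" using assms(2) by (auto simp: cube_def)
    with insert show ?case by (auto simp: chi_def)
  qed (simp add: chi_def)
qed

text \<open>The sum factorizes over the coordinates: one that lies in exactly one of
  \<open>S\<close> and \<open>T\<close> contributes \<open>-1 + 1 = 0\<close>, every other one
  contributes \<open>2\<close>.\<close>

lemma chi_orthogonal:
  assumes "S \<subseteq> {1..n}" "T \<subseteq> {1..n}"
  shows "(\<Sum>x\<in>cube n. chi S x * chi T x) = (if S = T then 2 ^ n else 0)"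
proof -
  define g where "g i y = (if i \<in> S then y else 1) * (if i \<in> T then y else (1::real))" for i y
  have "(\<Sum>x\<in>cube n. chi S x * chi T x) = (\<Sum>x\<in>{1..n} \<rightarrow>\<^sub>E {-1, 1}. \<Prod>i\<in>{1..n}. g i (x i))"
    by (simp add: cube_def g_def chi_eq_prod[OF assms(1)] chi_eq_prod[OF assms(2)] prod.distrib)
  also have "\<dots> = (\<Prod>i\<in>{1..n}. \<Sum>y\<in>{-1, 1}. g i y)"
    by (subst prod_sum_PiE) auto
  also have "\<dots> = (\<Prod>i\<in>{1..n}. if (i \<in> S) = (i \<in> T) then 2 else 0)"
    by (intro prod.cong) (auto simp: g_def)
  also have "\<dots> = (if S = T then 2 ^ n else 0)"
  proof (cases "S = T")
    case False
    then obtain i where "(i \<in> S) \<noteq> (i \<in> T)" by blast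
    moreover from this have "i \<in> {1..n}" using assms by blast
    ultimately have "(\<Prod>i\<in>{1..n}. if (i \<in> S) = (i \<in> T) then 2 else (0::real)) = 0"
      by (intro prod_zero) auto
    with False show ?thesis by simp
  qed simp
  finally show ?thesis .
qed

section \<open>Polynomials with integer coefficients\<close>

definition int_poly :: "nat set set \<Rightarrow> (nat set \<Rightarrow> int) \<Rightarrow> (nat \<Rightarrow> real) \<Rightarrow> real" where
  "int_poly I v x = (\<Sum>S\<in>I. of_int (v S) * chi S x)"

lemma int_poly_linear:
  "int_poly I (\<lambda>S. v S + w S) x = int_poly I v x + int_poly I w x"
  "int_poly I (\<lambda>S. v S - w S) x = int_poly I v x - int_poly I w x"
  "int_poly I (\<lambda>S. a * v S) x = of_int a * int_poly I v x"
  "int_poly I (\<lambda>S. - v S) x = - int_poly I v x"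
  by (simp_all add: int_poly_def algebra_simps sum.distrib sum_subtractf sum_distrib_left sum_negf)

text \<open>Fourier inversion: \<open>v S\<close> is the mean over the cube of the polynomial times
  \<open>chi S\<close>, a factor of absolute value 1. Hence nonzero integer polynomials have norm at
  least 1, and only finitely many stay below a given norm.\<close>

lemma int_poly_coeff_le:
  assumes "\<forall>x\<in>cube n. \<bar>int_poly (low_sets n d) v x\<bar> \<le> R" "S \<in> low_sets n d"
  shows "\<bar>of_int (v S)\<bar> \<le> (R::real)"
proof -
  have card: "card (cube n) = 2 ^ n" unfolding cube_def by (subst card_PiE) (auto simp: numeral_2_eq_2)
  have S: "S \<subseteq> {1..n}" using assms(2) by (simp add: low_sets_def)
  have "(\<Sum>x\<in>cube n. int_poly (low_sets n d) v x * chi S x)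
      = (\<Sum>x\<in>cube n. \<Sum>T\<in>low_sets n d. of_int (v T) * (chi T x * chi S x))"
    by (simp add: int_poly_def sum_distrib_right mult.assoc)
  also have "\<dots> = (\<Sum>T\<in>low_sets n d. of_int (v T) * (\<Sum>x\<in>cube n. chi T x * chi S x))"
    by (subst sum.swap) (simp add: sum_distrib_left)
  also have "\<dots> = (\<Sum>T\<in>low_sets n d. if T = S then of_int (v T) * 2 ^ n else 0)"
    using S by (intro sum.cong refl) (subst chi_orthogonal, auto simp: low_sets_def)
  also have "\<dots> = of_int (v S) * 2 ^ n"
    using assms(2) by simp
  finally have eq: "of_int (v S) * 2 ^ n = (\<Sum>x\<in>cube n. int_poly (low_sets n d) v x * chi S x)" ..
  have "\<bar>of_int (v S) * 2 ^ n\<bar> \<le> (\<Sum>x\<in>cube n. \<bar>int_poly (low_sets n d) v x * chi S x\<bar>)"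
    unfolding eq by (rule sum_abs)
  also have "\<dots> \<le> (\<Sum>x\<in>cube n. R)"
    using assms(1) chi_cases[OF S] by (intro sum_mono) (fastforce simp: abs_mult)
  finally have "\<bar>of_int (v S)\<bar> * 2 ^ n \<le> R * 2 ^ n"
    by (simp add: card abs_mult mult.commute)
  then show ?thesis by simp
qed

section \<open>Residue classes of lattices cut out by integer linear forms\<close>

text \<open>Coefficients off \<open>I\<close> are pinned to 0, so that vectors and their residues
  can be counted as functions on the whole type.\<close>

definition kernel_lattice :: "'a set \<Rightarrow> (nat \<Rightarrow> 'a \<Rightarrow> int) \<Rightarrow> nat \<Rightarrow> ('a \<Rightarrow> int) set" where
  "kernel_lattice I c m =
     {v \<in> PiE_dflt I 0 (\<lambda>_. UNIV). \<forall>t<m. (\<Sum>i\<in>I. c t i * v i) = 0}"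

definition residue :: "nat \<Rightarrow> ('a \<Rightarrow> int) \<Rightarrow> 'a \<Rightarrow> int" where
  "residue k v = (\<lambda>i. v i mod int k)"

lemma finite_residues:
  assumes "finite I" "0 < k" "V \<subseteq> PiE_dflt I 0 (\<lambda>_. UNIV)"
  shows "finite (residue k ` V)"
proof (rule finite_subset)
  show "residue k ` V \<subseteq> PiE_dflt I 0 (\<lambda>_. {0..<int k})"
    using assms(2,3) by (force simp: residue_def PiE_dflt_def)
  show "finite (PiE_dflt I 0 (\<lambda>_. {0..<int k}))" using assms(1) by (intro finite_PiE_dflt) auto
qed

text \<open>If the \<open>m\<close>-th form takes the least positive value \<open>g\<close> on the lattice of the first \<open>m\<close> forms,
  at \<open>v0\<close> say, then every vector of that lattice is a multiple of \<open>v0\<close> plus a vector of the next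
  lattice. So each form costs at most a factor \<open>k\<close>.\<close>

lemma card_residues_kernel_lattice:
  assumes "finite I" "0 < k"
  shows "k ^ card I \<le> k ^ m * card (residue k ` kernel_lattice I c m)"
proof (induction m)
  case 0
  \<comment> \<open>Without forms the lattice is everything, and vectors with entries in
    \<open>{0..<int k}\<close> are their own residues.\<close>
  have "PiE_dflt I 0 (\<lambda>_. {0..<int k}) \<subseteq> residue k ` kernel_lattice I c 0"
  proof
    fix v assume v: "v \<in> PiE_dflt I 0 (\<lambda>_. {0..<int k})"
    then have "v i mod int k = v i" for i
      by (cases "i \<in> I") (auto simp: PiE_dflt_def)
    then have "v = residue k v" by (simp add: residue_def)
    moreover have "v \<in> kernel_lattice I c 0" using v by (auto simp: kernel_lattice_def PiE_dflt_def)
    ultimately show "v \<in> residue k ` kernel_lattice I c 0" by blast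
  qed
  then have "card (PiE_dflt I 0 (\<lambda>_. {0..<int k})) \<le> card (residue k ` kernel_lattice I c 0)"
    by (rule card_mono[rotated])
      (rule finite_residues[OF assms], auto simp: kernel_lattice_def)
  then show ?case using assms(1) by (simp add: card_PiE_dflt)
next
  case (Suc m)
  define L where "L = kernel_lattice I c m"
  define L' where "L' = kernel_lattice I c (Suc m)"
  define \<phi> where "\<phi> v = (\<Sum>i\<in>I. c m i * v i)" for v
  have L'_eq: "L' = {v \<in> L. \<phi> v = 0}"
    by (auto simp: L_def L'_def kernel_lattice_def \<phi>_def less_Suc_eq)
  have fin: "finite (residue k ` L')"
    unfolding L'_def by (rule finite_residues[OF assms]) (auto simp: kernel_lattice_def)
  have comb: "(\<lambda>i. v i - a * w i) \<in> L" "\<phi> (\<lambda>i. v i - a * w i) = \<phi> v - a * \<phi> w"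
    if "v \<in> L" "w \<in> L" for a v w
  proof -
    have "(\<Sum>i\<in>I. c t i * (v i - a * w i)) = (\<Sum>i\<in>I. c t i * v i) - a * (\<Sum>i\<in>I. c t i * w i)" for t
      by (simp add: algebra_simps sum_subtractf sum_distrib_left)
    then show "(\<lambda>i. v i - a * w i) \<in> L" "\<phi> (\<lambda>i. v i - a * w i) = \<phi> v - a * \<phi> w"
      using that by (auto simp: L_def kernel_lattice_def PiE_dflt_def \<phi>_def)
  qed
  have "card (residue k ` L) \<le> k * card (residue k ` L')"
  proof (cases "\<exists>v\<in>L. \<phi> v > 0")
    case False
    have "\<phi> v = 0" if v: "v \<in> L" for v
    proof -
      \<comment> \<open>Subtracting \<open>v\<close> from the zero vector shows that
        \<open>L\<close> is closed under negation, so a form without positive values on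
        \<open>L\<close> has no negative ones either.\<close>
      have z: "(\<lambda>i. 0) \<in> L" by (auto simp: L_def kernel_lattice_def PiE_dflt_def)
      have "\<phi> (\<lambda>i. 0) = 0" by (simp add: \<phi>_def)
      then have *: "\<phi> (\<lambda>i. 0 - 1 * v i) = - \<phi> v" using comb(2)[OF z v, of 1] by simp
      show ?thesis using False comb(1)[OF z v, of 1] v unfolding *[symmetric]
        by (metis * linorder_neqE neg_0_less_iff_less)
    qed
    then have "L' = L" unfolding L'_eq by blast
    then show ?thesis using assms(2) by simp
  next
    case True
    define P where "P g \<longleftrightarrow> g > 0 \<and> (\<exists>v\<in>L. \<phi> v = int g)" for g
    define g where "g = (LEAST g. P g)"
    have "\<exists>g. P g"
    proof -
      from True obtain v where "v \<in> L" "\<phi> v > 0" by blast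
      then have "P (nat (\<phi> v))" by (auto simp: P_def)
      then show ?thesis ..
    qed
    then have "P g" unfolding g_def by (rule LeastI_ex)
    then obtain v0 where g: "g > 0" and v0: "v0 \<in> L" "\<phi> v0 = int g" by (auto simp: P_def)
    have minimal: "\<not> P h" if "h < g" for h using that unfolding g_def by (rule not_less_Least)
    \<comment> \<open>Modulo \<open>k\<close> only the multiples \<open>j * v0\<close> with
      \<open>j\<close> in \<open>{0..<int k}\<close> matter, whence the factor
      \<open>k\<close>.\<close>
    have "residue k ` L \<subseteq> (\<lambda>(j, r). residue k (\<lambda>i. r i + j * v0 i)) ` ({0..<int k} \<times> residue k ` L')"
    proof
      fix r assume "r \<in> residue k ` L"
      then obtain v where v: "v \<in> L" "r = residue k v" by blast
      \<comment> \<open>Division with remainder by \<open>g\<close>: the form takes the remainder as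
        its value at \<open>w\<close>, so minimality of \<open>g\<close> forces this value to be
        0.\<close>
      define a where "a = \<phi> v div int g"
      define w where "w = (\<lambda>i. v i - a * v0 i)"
      have "w \<in> L" unfolding w_def by (rule comb(1)[OF v(1) v0(1)])
      have "\<phi> w = \<phi> v mod int g"
        unfolding w_def comb(2)[OF v(1) v0(1)] v0(2) a_def by (simp add: minus_div_mult_eq_mod)
      moreover have "\<not> P (nat (\<phi> v mod int g))"
        using g by (intro minimal) (simp add: nat_less_iff)
      ultimately have "\<phi> w = 0" using \<open>w \<in> L\<close> g
        by (auto simp: P_def dest!: bspec[of _ _ w]) (metis g of_nat_0_less_iff order_le_less pos_mod_sign)
      with \<open>w \<in> L\<close> have "w \<in> L'" by (simp add: L'_eq)
      have "r = residue k (\<lambda>i. residue k w i + (a mod int k) * v0 i)"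
      proof
        fix i
        have "v i mod int k = (w i + a * v0 i) mod int k" by (simp add: w_def)
        also have "\<dots> = (w i mod int k + (a mod int k) * v0 i) mod int k"
          by (intro mod_add_cong) (simp_all add: mod_mult_left_eq)
        finally show "r i = residue k (\<lambda>i. residue k w i + (a mod int k) * v0 i) i"
          by (simp add: v(2) residue_def)
      qed
      then show "r \<in> (\<lambda>(j, r). residue k (\<lambda>i. r i + j * v0 i)) ` ({0..<int k} \<times> residue k ` L')"
        using \<open>w \<in> L'\<close> assms(2) by (intro image_eqI[of _ _ "(a mod int k, residue k w)"]) auto
    qed
    then have "card (residue k ` L) \<le> card ({0..<int k} \<times> residue k ` L')"
      by (rule surj_card_le[rotated]) (use fin in simp)
    then show ?thesis by (simp add: card_cartesian_product)
  qed
  then have "k ^ m * card (residue k ` L) \<le> k ^ Suc m * card (residue k ` L')"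
    by (simp add: mult.assoc)
  with Suc show ?case unfolding L_def L'_def by (rule order_trans)
qed

section \<open>Interpolation from finitely many values\<close>

text \<open>Induction on \<open>I\<close> in the manner of Newton interpolation: the error
  \<open>r\<close> of the old formula on the new function \<open>j\<close> selects the new node
  \<open>b\<close>.\<close>

lemma ex_interpolation:
  fixes \<phi> :: "'a \<Rightarrow> 'b \<Rightarrow> real"
  assumes "finite I" "X \<noteq> {}"
  shows "\<exists>(p :: nat \<Rightarrow> 'b) w. (\<forall>t<card I. p t \<in> X) \<and>
           (\<forall>i\<in>I. \<forall>x\<in>X. \<phi> i x = (\<Sum>t<card I. w t x * \<phi> i (p t)))"
  using assms(1)
proof (induction I rule: finite_induct)
  case empty
  then show ?case by simp
next
  case (insert j I)
  then obtain p and w :: "nat \<Rightarrow> 'b \<Rightarrow> real" where p: "\<And>t. t < card I \<Longrightarrow> p t \<in> X"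
    and w: "\<And>i x. i \<in> I \<Longrightarrow> x \<in> X \<Longrightarrow> \<phi> i x = (\<Sum>t<card I. w t x * \<phi> i (p t))"
    by blast
  define r where "r x = \<phi> j x - (\<Sum>t<card I. w t x * \<phi> j (p t))" for x
  \<comment> \<open>If \<open>r\<close> vanishes on \<open>X\<close>, any point serves as
    \<open>b\<close>; the weight \<open>u\<close> is then 0 because division by 0 gives 0.\<close>
  obtain b where b: "b \<in> X" "(\<exists>x\<in>X. r x \<noteq> 0) \<Longrightarrow> r b \<noteq> 0"
    using assms(2) by blast
  define u where "u x = r x / r b" for x
  have u: "r x = u x * r b" if "x \<in> X" for x
    using b that by (cases "r b = 0") (auto simp: u_def)
  define p' where "p' = p(card I := b)"
  \<comment> \<open>The update adds \<open>u x\<close> times the error of the old formula at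
    \<open>b\<close>. This error is 0 for the functions in \<open>I\<close> and \<open>r b\<close>
    for \<open>j\<close>.\<close>
  define w' where "w' t x = (if t = card I then u x else w t x - u x * w t b)" for t x
  have "\<phi> i x = (\<Sum>t<card (insert j I). w' t x * \<phi> i (p' t))" if "i \<in> insert j I" "x \<in> X" for i x
  proof -
    have "(\<Sum>t<card (insert j I). w' t x * \<phi> i (p' t))
        = (\<Sum>t<card I. (w t x - u x * w t b) * \<phi> i (p t)) + u x * \<phi> i b"
      using insert by (simp add: w'_def p'_def)
    also have "(\<Sum>t<card I. (w t x - u x * w t b) * \<phi> i (p t))
        = (\<Sum>t<card I. w t x * \<phi> i (p t)) - u x * (\<Sum>t<card I. w t b * \<phi> i (p t))"
      by (simp add: algebra_simps sum_subtractf sum_distrib_left)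
    finally have *: "(\<Sum>t<card (insert j I). w' t x * \<phi> i (p' t))
        = (\<Sum>t<card I. w t x * \<phi> i (p t)) + u x * (\<phi> i b - (\<Sum>t<card I. w t b * \<phi> i (p t)))"
      by (simp add: algebra_simps)
    show ?thesis
    proof (cases "i = j")
      case True
      then show ?thesis unfolding * using u[OF that(2)] by (simp add: r_def)
    next
      case False
      then have "i \<in> I" using that by simp
      then show ?thesis unfolding * using w[of i b] w[of i x] b(1) that by simp
    qed
  qed
  moreover have "\<forall>t<card (insert j I). p' t \<in> X"
    using p b(1) insert by (auto simp: p'_def less_Suc_eq)
  ultimately show ?case by blast
qed

section \<open>Transcripts of adaptive learners\<close>

lemma snd_transcript: "t < m \<Longrightarrow> snd (transcript q f m t) = f (fst (transcript q f m t))"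
proof (induction m)
  case (Suc m)
  then show ?case by (cases "t = m") (simp_all add: Let_def)
qed simp

text \<open>Each query depends only on earlier answers, so by induction it suffices to compare the
  functions at the points queried for \<open>f\<close>.\<close>

lemma transcript_cong:
  assumes "\<And>t. t < m \<Longrightarrow> f' (fst (transcript q f m t)) = f (fst (transcript q f m t))"
  shows "transcript q f' m = transcript q f m"
  using assms
proof (induction m)
  case (Suc m)
  have "transcript q f' m = transcript q f m"
  proof (rule Suc.IH)
    fix t assume "t < m"
    then show "f' (fst (transcript q f m t)) = f (fst (transcript q f m t))"
      using Suc.prems[of t] by (simp add: Let_def)
  qed
  then show ?case using Suc.prems[of m] by (simp add: Let_def)
qed simp

lemma transcript_in_history_space:
  assumes "\<And>t h. t < m \<Longrightarrow> h \<in> space (history_space n t) \<Longrightarrow> q t h \<in> cube n"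
  shows "transcript q f m \<in> space (history_space n m)"
  using assms
proof (induction m)
  case 0
  then show ?case by (simp add: history_space_def space_PiM)
next
  case (Suc m)
  then have "transcript q f m \<in> space (history_space n m)" by simp
  moreover from this have "q m (transcript q f m) \<in> cube n" by (intro Suc.prems) auto
  ultimately show ?case
    by (auto simp: history_space_def space_PiM space_pair_measure Let_def PiE_def Pi_def
        extensional_def less_Suc_eq)
qed

lemma fst_transcript_in_cube:
  assumes "\<And>t h. t < m \<Longrightarrow> h \<in> space (history_space n t) \<Longrightarrow> q t h \<in> cube n" "t < m"
  shows "fst (transcript q f m t) \<in> cube n"
proof -
  have "transcript q f m t \<in> cube n \<times> (UNIV :: real set)"
    using transcript_in_history_space[OF assms(1), where f = f] assms(2)
    by (auto simp: history_space_def space_PiM space_pair_measure PiE_def Pi_def)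
  then show ?thesis by auto
qed

section \<open>Vanishing integer polynomials and the deterministic lower bound\<close>

lemma scaled_int_poly_in_bounded_polys:
  assumes "\<forall>x\<in>cube n. \<bar>int_poly (low_sets n d) v x\<bar> \<le> R" "0 < R"
  shows "(\<lambda>x. int_poly (low_sets n d) v x / R) \<in> bounded_polys n d"
  unfolding bounded_polys_def
proof (intro CollectI conjI exI ballI)
  fix x
  show "int_poly (low_sets n d) v x / R
      = (\<Sum>S | S \<subseteq> {1..n} \<and> card S \<le> d. of_int (v S) / R * chi S x)"
    by (simp add: int_poly_def low_sets_def sum_divide_distrib)
qed (use assms in \<open>simp add: Linf_norm_le_iff\<close>)

text \<open>Evaluation at \<open>X t\<close> is an integer linear form, so the polynomials vanishing
  at all these points form a kernel lattice; \<open>V\<close> picks one vector from each of its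
  residue classes.\<close>

lemma ex_vanishing_residues:
  fixes n d m k :: nat
  assumes "\<And>t. t < m \<Longrightarrow> X t \<in> cube n" "0 < k"
  defines "I \<equiv> low_sets n d"
  assumes "m \<le> card I"
  shows "\<exists>V. finite V \<and> V \<subseteq> PiE_dflt I 0 (\<lambda>_. UNIV) \<and> inj_on (residue k) V \<and>
           k ^ (card I - m) \<le> card V \<and> (\<forall>v\<in>V. \<forall>t<m. int_poly I v (X t) = 0)"
proof -
  \<comment> \<open>The floor only turns the real value 1 or -1 of a character into an
    integer.\<close>
  define c where "c t S = \<lfloor>chi S (X t)\<rfloor>" for t S
  define L where "L = kernel_lattice I c m"
  have fin: "finite I" by (simp add: I_def)
  have L: "L \<subseteq> PiE_dflt I 0 (\<lambda>_. UNIV)" by (auto simp: L_def kernel_lattice_def)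
  obtain V where V: "V \<subseteq> L" "inj_on (residue k) V" "residue k ` V = residue k ` L"
    using subset_image_inj[of "residue k ` L" "residue k" L, THEN iffD1, OF subset_refl] by metis
  have "finite (residue k ` V)" using finite_residues[OF fin assms(2) L] V(3) by simp
  then have fV: "finite V" using V(2) by (rule finite_imageD)
  have "k ^ m * k ^ (card I - m) = k ^ card I" using assms(4) by (simp flip: power_add)
  also have "\<dots> \<le> k ^ m * card (residue k ` L)"
    unfolding L_def by (rule card_residues_kernel_lattice[OF fin assms(2)])
  also have "card (residue k ` L) = card V" unfolding V(3)[symmetric] by (rule card_image[OF V(2)])
  finally have "k ^ m * k ^ (card I - m) \<le> k ^ m * card V" .
  then have card: "k ^ (card I - m) \<le> card V" using assms(2) by simp
  have "int_poly I v (X t) = 0" if "v \<in> V" "t < m" for v t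
  proof -
    have "of_int (c t S) = chi S (X t)" if "S \<in> I" for S
    proof -
      have "chi S (X t) = of_int 1 \<or> chi S (X t) = of_int (-1)"
        using chi_cases[of S n "X t"] assms(1)[OF \<open>t < m\<close>] that by (auto simp: I_def low_sets_def)
      then show ?thesis unfolding c_def by (elim disjE) simp_all
    qed
    then have "int_poly I v (X t) = of_int (\<Sum>S\<in>I. c t S * v S)"
      by (simp add: int_poly_def mult.commute)
    also have "(\<Sum>S\<in>I. c t S * v S) = 0" using that V(1) by (auto simp: L_def kernel_lattice_def)
    finally show ?thesis by simp
  qed
  then show ?thesis using V(1,2) L fV card by (intro exI[of _ V] conjI) auto
qed

lemma det_recovers_imp_card_le:
  assumes rec: "det_recovers n (bounded_polys n d) \<epsilon> m" and "\<epsilon> < 1"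
  shows "card (low_sets n d) \<le> m"
proof (rule ccontr)
  assume "\<not> card (low_sets n d) \<le> m"
  then have less: "m < card (low_sets n d)" by simp
  from rec obtain q and out :: "history \<Rightarrow> (nat \<Rightarrow> real) \<Rightarrow> real" where
    q: "\<And>t h. t < m \<Longrightarrow> h \<in> space (history_space n t) \<Longrightarrow> q t h \<in> cube n"
    and out: "\<And>f x. f \<in> bounded_polys n d \<Longrightarrow> x \<in> cube n \<Longrightarrow>
      \<bar>f x - out (transcript q f m) x\<bar> \<le> \<epsilon>"
    unfolding det_recovers_def det_learner_def Linf_norm_le_iff by blast
  define h where "h = transcript q (\<lambda>_. 0) m"
  \<comment> \<open>Modulus 2 suffices here: at least two residue classes force a nonzero vector
    into \<open>V\<close>.\<close>
  obtain V where V: "finite V" "V \<subseteq> PiE_dflt (low_sets n d) 0 (\<lambda>_. UNIV)"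
    "2 ^ (card (low_sets n d) - m) \<le> card V"
    "\<And>v t. v \<in> V \<Longrightarrow> t < m \<Longrightarrow> int_poly (low_sets n d) v (fst (h t)) = 0"
    using ex_vanishing_residues[of m "\<lambda>t. fst (h t)" n 2 d] less
      fst_transcript_in_cube[of m n q _ "\<lambda>_. 0", OF q] unfolding h_def by auto
  have "\<not> V \<subseteq> {\<lambda>_. 0}"
  proof
    assume "V \<subseteq> {\<lambda>_. 0}"
    then have "card V \<le> card {\<lambda>_ :: nat set. 0 :: int}" by (intro card_mono) auto
    moreover have "(2::nat) ^ 1 \<le> 2 ^ (card (low_sets n d) - m)"
      using less by (intro power_increasing) auto
    ultimately show False using V(3) by simp
  qed
  then obtain v S where v: "v \<in> V" "v S \<noteq> 0" by auto
  then have S: "S \<in> low_sets n d" using V(2) by (auto simp: PiE_dflt_def)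
  define F where "F = int_poly (low_sets n d) v"
  define R where "R = Linf_norm n F"
  have "R \<in> (\<lambda>x. \<bar>F x\<bar>) ` cube n" unfolding R_def Linf_norm_def by (intro Max_in) auto
  then obtain x where x: "x \<in> cube n" "\<bar>F x\<bar> = R" by auto
  have R: "\<forall>x\<in>cube n. \<bar>F x\<bar> \<le> R" using Linf_norm_le_iff[of n F R] by (simp add: R_def)
  then have "\<bar>of_int (v S)\<bar> \<le> R" unfolding F_def using S by (rule int_poly_coeff_le)
  then have "0 < R" using v(2) by linarith
  have neg: "int_poly (low_sets n d) (\<lambda>S. - v S) = (\<lambda>x. - F x)"
    by (simp add: F_def fun_eq_iff int_poly_linear)
  have "(\<lambda>x. F x / R) \<in> bounded_polys n d" "(\<lambda>x. - F x / R) \<in> bounded_polys n d"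
    using scaled_int_poly_in_bounded_polys[of n d v R]
      scaled_int_poly_in_bounded_polys[of n d "\<lambda>S. - v S" R] R \<open>0 < R\<close>
    by (simp_all add: neg F_def[symmetric])
  moreover have "transcript q (\<lambda>x. F x / R) m = h" "transcript q (\<lambda>x. - F x / R) m = h"
    unfolding h_def by (rule transcript_cong; use V(4) v(1) in \<open>simp add: F_def h_def\<close>)+
  ultimately have "\<bar>F x / R - out h x\<bar> \<le> \<epsilon>" "\<bar>- F x / R - out h x\<bar> \<le> \<epsilon>"
    using out[of "\<lambda>x. F x / R" x] out[of "\<lambda>x. - F x / R" x] x(1) by simp_all
  \<comment> \<open>At a point where the norm is attained the two candidates take the values 1 and
    -1, and no output is within \<open>\<epsilon> < 1\<close> of both.\<close>
  moreover have "F x / R = 1 \<or> F x / R = -1"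
    using x(2) \<open>0 < R\<close> by (auto simp: field_simps abs_if split: if_splits)
  ultimately show False using \<open>\<epsilon> < 1\<close> by auto
qed

section \<open>Counting integer polynomials of bounded norm\<close>

definition poly_box :: "nat \<Rightarrow> nat \<Rightarrow> real \<Rightarrow> (nat set \<Rightarrow> int) set" where
  "poly_box n d R = {v \<in> PiE_dflt (low_sets n d) 0 (\<lambda>_. UNIV).
     \<forall>x\<in>cube n. \<bar>int_poly (low_sets n d) v x\<bar> \<le> R}"

lemma finite_poly_box [simp]: "finite (poly_box n d R)"
proof (rule finite_subset)
  show "poly_box n d R \<subseteq> PiE_dflt (low_sets n d) 0 (\<lambda>_. {-\<lceil>R\<rceil>..\<lceil>R\<rceil>})"
  proof
    fix v assume v: "v \<in> poly_box n d R"
    have "\<bar>v S\<bar> \<le> \<lceil>R\<rceil>" if "S \<in> low_sets n d" for S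
    proof -
      have "\<bar>of_int (v S)\<bar> \<le> R" using v that by (intro int_poly_coeff_le) (auto simp: poly_box_def)
      then show ?thesis by linarith
    qed
    with v show "v \<in> PiE_dflt (low_sets n d) 0 (\<lambda>_. {-\<lceil>R\<rceil>..\<lceil>R\<rceil>})"
      by (fastforce simp: poly_box_def PiE_dflt_def abs_le_iff)
  qed
  show "finite (PiE_dflt (low_sets n d) 0 (\<lambda>_. {-\<lceil>R\<rceil>..\<lceil>R\<rceil>}))" by (intro finite_PiE_dflt) auto
qed

text \<open>Divide each coefficient by 3, with \<open>D = card (low_sets n d)\<close>. The
  remainders are at most 2 and form a polynomial of norm at most \<open>2 * D \<le> R\<close>, so
  the quotients have norm at most \<open>(2 * R + R) / 3 = R\<close>. There are \<open>3 ^ D\<close>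
  remainder vectors.\<close>

lemma card_poly_box_double:
  assumes "2 * real (card (low_sets n d)) \<le> R"
  shows "card (poly_box n d (2 * R)) \<le> 3 ^ card (low_sets n d) * card (poly_box n d R)"
proof -
  define I where "I = low_sets n d"
  define P where "P = PiE_dflt I (0::int) (\<lambda>_. {0..<3})"
  have fP: "finite P" unfolding P_def by (intro finite_PiE_dflt) (auto simp: I_def)
  have "poly_box n d (2 * R) \<subseteq> (\<lambda>(u, s) S. 3 * u S + s S) ` (poly_box n d R \<times> P)"
  proof
    fix v assume v: "v \<in> poly_box n d (2 * R)"
    define u where "u S = v S div 3" for S
    define s where "s S = v S mod 3" for S
    have vus: "v S = 3 * u S + s S" for S by (simp add: u_def s_def)
    have "\<bar>int_poly I u x\<bar> \<le> R" if x: "x \<in> cube n" for x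
    proof -
      have "\<bar>int_poly I s x\<bar> \<le> (\<Sum>S\<in>I. \<bar>of_int (s S) * chi S x\<bar>)"
        unfolding int_poly_def by (rule sum_abs)
      also have "\<dots> \<le> (\<Sum>S\<in>I. 2)"
      proof (rule sum_mono)
        fix S assume "S \<in> I"
        then have "\<bar>chi S x\<bar> = 1" using chi_cases[OF _ x, of S] by (auto simp: I_def low_sets_def)
        moreover have "0 \<le> s S" "s S \<le> 2" by (auto simp: s_def)
        ultimately show "\<bar>of_int (s S) * chi S x\<bar> \<le> 2" by (simp add: abs_mult)
      qed
      finally have "\<bar>int_poly I s x\<bar> \<le> R" using assms by (simp add: I_def)
      moreover have "int_poly I v x = 3 * int_poly I u x + int_poly I s x"
        by (simp add: vus[abs_def] int_poly_linear)
      moreover have "\<bar>int_poly I v x\<bar> \<le> 2 * R" using v x by (auto simp: poly_box_def I_def)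
      ultimately show ?thesis by linarith
    qed
    then have "u \<in> poly_box n d R" using v by (auto simp: poly_box_def u_def PiE_dflt_def I_def)
    moreover have "s \<in> P" using v by (auto simp: poly_box_def s_def PiE_dflt_def I_def P_def)
    ultimately show "v \<in> (\<lambda>(u, s) S. 3 * u S + s S) ` (poly_box n d R \<times> P)"
      by (intro image_eqI[of _ _ "(u, s)"]) (auto simp: vus)
  qed
  then have "card (poly_box n d (2 * R)) \<le> card (poly_box n d R \<times> P)"
    by (rule surj_card_le[rotated]) (use fP in simp)
  also have "\<dots> = 3 ^ card I * card (poly_box n d R)"
    by (simp add: P_def card_cartesian_product card_PiE_dflt I_def)
  finally show ?thesis by (simp only: I_def)
qed

text \<open>The scale \<open>R\<close> of the test polynomials has to be fixed before the query
  points are known, so one bound \<open>C\<close> must serve all of the finitely many tuples of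
  points.\<close>

lemma ex_uniform_vanishing_residues:
  assumes "0 < k" "m \<le> card (low_sets n d)"
  shows "\<exists>C V. \<forall>X\<in>{..<m} \<rightarrow>\<^sub>E cube n. V X \<subseteq> poly_box n d C \<and> inj_on (residue k) (V X) \<and>
           k ^ (card (low_sets n d) - m) \<le> card (V X) \<and>
           (\<forall>v\<in>V X. \<forall>t<m. int_poly (low_sets n d) v (X t) = 0)"
proof -
  define I where "I = low_sets n d"
  have "\<forall>X\<in>{..<m} \<rightarrow>\<^sub>E cube n. \<exists>V. finite V \<and> V \<subseteq> PiE_dflt I 0 (\<lambda>_. UNIV) \<and> inj_on (residue k) V \<and>
           k ^ (card I - m) \<le> card V \<and> (\<forall>v\<in>V. \<forall>t<m. int_poly I v (X t) = 0)"
    unfolding I_def by (intro ballI ex_vanishing_residues assms) (auto simp: PiE_def Pi_def)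
  from bchoice[OF this] obtain V where V: "\<forall>X\<in>{..<m} \<rightarrow>\<^sub>E cube n. finite (V X) \<and>
      V X \<subseteq> PiE_dflt I 0 (\<lambda>_. UNIV) \<and> inj_on (residue k) (V X) \<and>
      k ^ (card I - m) \<le> card (V X) \<and> (\<forall>v\<in>V X. \<forall>t<m. int_poly I v (X t) = 0)" ..
  define W where "W = (\<Union>X\<in>{..<m} \<rightarrow>\<^sub>E cube n. V X)"
  \<comment> \<open>Any common bound will do; adding up all absolute values is a crude one.\<close>
  define C where "C = (\<Sum>v\<in>W. \<Sum>x\<in>cube n. \<bar>int_poly I v x\<bar>)"
  have "finite W" unfolding W_def using V by (intro finite_UN_I finite_PiE) auto
  then have "\<bar>int_poly I v x\<bar> \<le> C" if "v \<in> W" "x \<in> cube n" for v x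
  proof -
    have "\<bar>int_poly I v x\<bar> \<le> (\<Sum>x\<in>cube n. \<bar>int_poly I v x\<bar>)"
      using that by (intro member_le_sum) auto
    also have "\<dots> \<le> C" unfolding C_def
      using that \<open>finite W\<close> by (intro member_le_sum[where f = "\<lambda>v. \<Sum>x\<in>cube n. \<bar>int_poly I v x\<bar>"]) (auto intro: sum_nonneg)
    finally show ?thesis .
  qed
  moreover have "V X \<subseteq> PiE_dflt I 0 (\<lambda>_. UNIV)" if "X \<in> {..<m} \<rightarrow>\<^sub>E cube n" for X
    using V that by simp
  ultimately have "V X \<subseteq> poly_box n d C" if "X \<in> {..<m} \<rightarrow>\<^sub>E cube n" for X
    using that unfolding poly_box_def W_def I_def by blast
  with V show ?thesis unfolding I_def by (intro exI[of _ C] exI[of _ V]) simp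
qed

text \<open>Within a class of equal transcripts, successes differ from a representative \<open>w\<close> by at most
  \<open>2 * \<epsilon> * R\<close>. Stretching these differences by \<open>9\<close> and filling the gaps with the residue
  representatives \<open>r\<close>, which vanish at the query points, stays inside the doubled box.\<close>

lemma card_successes_le:
  assumes q: "\<And>t h. t < m \<Longrightarrow> h \<in> space (history_space n t) \<Longrightarrow> q t h \<in> cube n"
    and m: "2 * m < card (low_sets n d)" and \<epsilon>: "\<epsilon> < 1 / 30"
    and V: "\<forall>X\<in>{..<m} \<rightarrow>\<^sub>E cube n. V X \<subseteq> poly_box n d C \<and> inj_on (residue 9) (V X) \<and>
           9 ^ (card (low_sets n d) - m) \<le> card (V X) \<and>
           (\<forall>v\<in>V X. \<forall>t<m. int_poly (low_sets n d) v (X t) = 0)"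
    and R: "0 < R" "2 * real (card (low_sets n d)) \<le> R" "C \<le> 2 / 5 * R"
  defines "F \<equiv> \<lambda>v x. int_poly (low_sets n d) v x / R"
  shows "3 * card {v \<in> poly_box n d R. \<forall>x\<in>cube n. \<bar>F v x - out (transcript q (F v) m) x\<bar> \<le> \<epsilon>}
           \<le> card (poly_box n d R)"
proof -
  define A where "A = {v \<in> poly_box n d R. \<forall>x\<in>cube n. \<bar>F v x - out (transcript q (F v) m) x\<bar> \<le> \<epsilon>}"
  define D where "D = card (low_sets n d)"
  define T where "T v = transcript q (F v) m" for v
  define X where "X v = (\<lambda>t\<in>{..<m}. fst (T v t))" for v
  \<comment> \<open>The representative depends on \<open>v\<close> only through the transcript
    \<open>T v\<close>.\<close>
  define w where "w v = (SOME w. w \<in> A \<and> T w = T v)" for v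
  have w: "w v \<in> A \<and> T (w v) = T v" if "v \<in> A" for v
    unfolding w_def by (rule someI[of _ v]) (use that in simp)
  define \<Phi> where "\<Phi> = (\<lambda>(v, r) S. w v S + 9 * (v S - w v S) + r S :: int)"
  have X: "X v \<in> {..<m} \<rightarrow>\<^sub>E cube n" for v
    using fst_transcript_in_cube[OF q] by (auto simp: X_def T_def)
  have F_\<Phi>: "F (\<Phi> (v, r)) x = F (w v) x + 9 * (F v x - F (w v) x) + F r x" for v r x
  proof -
    have "int_poly (low_sets n d) (\<Phi> (v, r)) x = int_poly (low_sets n d) (w v) x +
      9 * (int_poly (low_sets n d) v x - int_poly (low_sets n d) (w v) x) + int_poly (low_sets n d) r x"
      by (simp add: \<Phi>_def int_poly_linear)
    then show ?thesis using R(1) by (simp add: F_def field_simps)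
  qed
  \<comment> \<open>As \<open>\<Phi>\<close> preserves the transcript, \<open>T v\<close>, and with
    it \<open>w v\<close> and \<open>X v\<close>, can be read off from the image.\<close>
  have T_\<Phi>: "T (\<Phi> (v, r)) = T v" if "v \<in> A" "r \<in> V (X v)" for v r
  proof -
    have "T (\<Phi> (v, r)) = T (w v)" unfolding T_def
    proof (rule transcript_cong)
      fix t assume t: "t < m"
      define x where "x = fst (transcript q (F (w v)) m t)"
      have x: "x = X v t" "x = fst (T v t)" using t w[OF that(1)] by (simp_all add: x_def X_def T_def)
      \<comment> \<open>The answers recorded in the common transcript force agreement at the queried
        point.\<close>
      have "F v x = F (w v) x"
        using snd_transcript[OF t, of q "F v"] snd_transcript[OF t, of q "F (w v)"] w[OF that(1)] x(2)
        by (simp add: T_def)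
      moreover have "F r x = 0" using V X[of v] that(2) t by (simp add: F_def x(1))
      ultimately show "F (\<Phi> (v, r)) (fst (transcript q (F (w v)) m t))
          = F (w v) (fst (transcript q (F (w v)) m t))"
        by (simp add: F_\<Phi> flip: x_def)
    qed
    then show ?thesis using w[OF that(1)] by simp
  qed
  have inj: "inj_on \<Phi> (SIGMA v:A. V (X v))"
  proof (rule inj_onI, clarify)
    fix v r v' r'
    assume v: "v \<in> A" "r \<in> V (X v)" "v' \<in> A" "r' \<in> V (X v')" and eq: "\<Phi> (v, r) = \<Phi> (v', r')"
    have T: "T v = T v'" using T_\<Phi>[OF v(1,2)] T_\<Phi>[OF v(3,4)] eq by simp
    then have w_eq: "w v = w v'" and X_eq: "X v = X v'" by (simp_all add: w_def X_def)
    \<comment> \<open>The terms in \<open>w\<close> coincide and cancel. Modulo 9 only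
      \<open>r\<close> and \<open>r'\<close> remain, and \<open>residue 9\<close> is injective on
      \<open>V (X v)\<close>.\<close>
    have S: "9 * v S + r S = 9 * v' S + r' S" for S
      using fun_cong[OF eq, of S] by (simp add: \<Phi>_def w_eq)
    then have "(9 * v S + r S) mod 9 = (9 * v' S + r' S) mod 9" for S by simp
    then have "residue 9 r = residue 9 r'" by (simp add: residue_def)
    then have "r = r'" using V X[of v] v(2,4) X_eq by (auto dest!: inj_onD)
    then show "v = v' \<and> r = r'" using S by auto
  qed
  have range: "\<Phi> ` (SIGMA v:A. V (X v)) \<subseteq> poly_box n d (2 * R)"
  proof clarify
    fix v r assume v: "v \<in> A" "r \<in> V (X v)"
    have r: "r \<in> poly_box n d C" using V X[of v] v(2) by blast
    have "\<bar>int_poly (low_sets n d) (\<Phi> (v, r)) x\<bar> \<le> 2 * R" if x: "x \<in> cube n" for x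
    proof -
      define b where "b = F v x - F (w v) x"
      have "\<bar>F v x - out (T v) x\<bar> \<le> \<epsilon>" "\<bar>F (w v) x - out (T v) x\<bar> \<le> \<epsilon>"
        using v(1) w[OF v(1)] x unfolding A_def T_def by (auto dest: bspec)
      then have "\<bar>b\<bar> < 1 / 15" unfolding b_def using \<epsilon> by linarith
      moreover have "\<bar>F (w v) x\<bar> \<le> 1"
        using w[OF v(1)] x R(1) by (auto simp: A_def poly_box_def F_def)
      moreover have "\<bar>F r x\<bar> \<le> 2 / 5"
      proof -
        have "\<bar>int_poly (low_sets n d) r x\<bar> \<le> 2 / 5 * R"
          using r x R(3) by (force simp: poly_box_def)
        then show ?thesis using R(1) by (simp add: F_def field_simps)
      qed
      \<comment> \<open>The three contributions add up to at most
        \<open>1 + 9 / 15 + 2 / 5 = 2\<close>.\<close>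
      ultimately have "\<bar>F (\<Phi> (v, r)) x\<bar> \<le> 2" 
        unfolding F_\<Phi> b_def[symmetric] by linarith
      then show ?thesis using R(1) by (simp add: F_def field_simps)
    qed
    moreover have "v \<in> poly_box n d R" "w v \<in> poly_box n d R"
      using v(1) w[OF v(1)] by (auto simp: A_def)
    ultimately show "\<Phi> (v, r) \<in> poly_box n d (2 * R)"
      using r by (auto simp: poly_box_def \<Phi>_def PiE_dflt_def)
  qed
  have fA: "finite A" by (simp add: A_def)
  have "card A * 9 ^ (D - m) = (\<Sum>v\<in>A. 9 ^ (D - m))" by simp
  also have "\<dots> \<le> (\<Sum>v\<in>A. card (V (X v)))"
    using V X unfolding D_def by (intro sum_mono) blast
  also have "\<dots> = card (SIGMA v:A. V (X v))"
    by (intro card_SigmaI[symmetric] fA ballI finite_subset[OF _ finite_poly_box[of n d C]])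
      (use V X in blast)
  also have "\<dots> = card (\<Phi> ` (SIGMA v:A. V (X v)))" using inj by (simp add: card_image)
  also have "\<dots> \<le> card (poly_box n d (2 * R))" by (intro card_mono range) simp
  also have "\<dots> \<le> 3 ^ D * card (poly_box n d R)" unfolding D_def using R(2) by (rule card_poly_box_double)
  finally have le: "card A * 9 ^ (D - m) \<le> 3 ^ D * card (poly_box n d R)" .
  \<comment> \<open>From \<open>2 * m < D\<close> follows \<open>D + 1 \<le> 2 * (D - m)\<close>;
    the spare factor 3 is what limits the successes to one third.\<close>
  have "(3::nat) ^ Suc D \<le> 3 ^ (2 * (D - m))" using m by (intro power_increasing) (auto simp: D_def)
  also have "\<dots> = 9 ^ (D - m)" by (simp add: power_mult)
  finally have "card A * (3 * 3 ^ D) \<le> card A * 9 ^ (D - m)" by (intro mult_left_mono) auto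
  from order_trans[OF this le] have "3 ^ D * (3 * card A) \<le> 3 ^ D * card (poly_box n d R)"
    by (simp only: mult_ac)
  then show ?thesis by (simp add: A_def)
qed

section \<open>Measurability for randomized learners\<close>

lemma measurable_transcript:
  assumes "rand_learner M n m q out" "t \<le> m"
  shows "(\<lambda>\<omega>. transcript (q \<omega>) f t) \<in> M \<rightarrow>\<^sub>M history_space n t"
  using assms(2)
proof (induction t)
  case 0
  show ?case by (simp add: history_space_def space_PiM)
next
  case (Suc t)
  then have IH: "(\<lambda>\<omega>. transcript (q \<omega>) f t) \<in> M \<rightarrow>\<^sub>M history_space n t" by simp
  define x where "x \<omega> = q \<omega> t (transcript (q \<omega>) f t)" for \<omega>
  have "(\<lambda>(\<omega>, h). q \<omega> t h) \<in> M \<Otimes>\<^sub>M history_space n t \<rightarrow>\<^sub>M count_space (cube n)"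
    using assms(1) Suc.prems by (simp add: rand_learner_def)
  from measurable_compose[OF measurable_Pair[OF measurable_ident_sets[OF refl] IH] this]
  have x: "x \<in> M \<rightarrow>\<^sub>M count_space (cube n)" by (simp add: x_def[abs_def])
  \<comment> \<open>Queries take values in a discrete space, on which every \<open>f\<close> is
    measurable.\<close>
  then have "(\<lambda>\<omega>. f (x \<omega>)) \<in> borel_measurable M"
    by (rule measurable_compose) simp
  with x have "(\<lambda>\<omega>. (x \<omega>, f (x \<omega>))) \<in> M \<rightarrow>\<^sub>M count_space (cube n) \<Otimes>\<^sub>M borel"
    by (rule measurable_Pair)
  with IH have "(\<lambda>\<omega>. (transcript (q \<omega>) f t)(t := (x \<omega>, f (x \<omega>)))) \<in> M \<rightarrow>\<^sub>M history_space n (Suc t)"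
    unfolding history_space_def
    by (rule measurable_fun_upd[where J = "{..<t}", rotated]) auto
  then show ?case by (simp add: Let_def x_def del: fun_upd_apply)
qed

text \<open>Since \<open>measure\<close> is 0 outside \<open>sets M\<close>, a bound on the failure
  probability carries information only for measurable events.\<close>

lemma sets_failure:
  assumes "rand_learner M n m q out"
  shows "{\<omega> \<in> space M. Linf_norm n (\<lambda>x. f x - out \<omega> (transcript (q \<omega>) f m) x) > \<epsilon>} \<in> sets M"
proof -
  have "(\<lambda>\<omega>. out \<omega> (transcript (q \<omega>) f m) x) \<in> borel_measurable M" if "x \<in> cube n" for x
  proof -
    have "(\<lambda>(\<omega>, h). out \<omega> h x) \<in> borel_measurable (M \<Otimes>\<^sub>M history_space n m)"
      using assms that by (simp add: rand_learner_def)
    from measurable_compose[OF measurable_Pair[OF measurable_ident_sets[OF refl]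
        measurable_transcript[OF assms order_refl]] this]
    show ?thesis by simp
  qed
  then have "(\<lambda>\<omega>. \<bar>f x - out \<omega> (transcript (q \<omega>) f m) x\<bar>) \<in> borel_measurable M" if "x \<in> cube n" for x
    using that by simp
  then have "(\<lambda>\<omega>. Linf_norm n (\<lambda>x. f x - out \<omega> (transcript (q \<omega>) f m) x)) \<in> borel_measurable M"
    unfolding Linf_norm_def by (rule borel_measurable_Max[OF finite_cube])
  then show ?thesis unfolding borel_measurable_iff_greater by (rule spec)
qed

section \<open>The randomized lower bound\<close>

text \<open>Averaging: for each \<open>\<omega>\<close> at least two thirds of the test polynomials
  are failures, so their failure probabilities average at least \<open>2 / 3\<close>, whereas each
  is at most \<open>\<delta>\<close>.\<close>

lemma rand_recovers_imp_card_le: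
  assumes rec: "rand_recovers TYPE('w) n (bounded_polys n d) \<epsilon> \<delta> m"
    and \<epsilon>: "\<epsilon> < 1 / 30" and \<delta>: "\<delta> < 2 / 3"
  shows "card (low_sets n d) \<le> 2 * m"
proof (rule ccontr)
  assume "\<not> card (low_sets n d) \<le> 2 * m"
  then have less: "2 * m < card (low_sets n d)" by simp
  from rec obtain M :: "'w measure" and q out where L: "rand_learner M n m q out"
    and fail: "\<And>f. f \<in> bounded_polys n d \<Longrightarrow> measure M {\<omega> \<in> space M.
            Linf_norm n (\<lambda>x. f x - out \<omega> (transcript (q \<omega>) f m) x) > \<epsilon>} \<le> \<delta>"
    unfolding rand_recovers_def by blast
  interpret prob_space M using L by (simp add: rand_learner_def)
  have "m \<le> card (low_sets n d)" using less by simp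
  from ex_uniform_vanishing_residues[of 9, OF zero_less_numeral this]
  obtain C V where V: "\<forall>X\<in>{..<m} \<rightarrow>\<^sub>E cube n. V X \<subseteq> poly_box n d C \<and> inj_on (residue 9) (V X) \<and>
           9 ^ (card (low_sets n d) - m) \<le> card (V X) \<and>
           (\<forall>v\<in>V X. \<forall>t<m. int_poly (low_sets n d) v (X t) = 0)"
    by (elim exE)
  \<comment> \<open>The summands provide positivity, the condition of the doubling estimate, and
    room for the residue vectors.\<close>
  define R where "R = 1 + 2 * real (card (low_sets n d)) + 5 / 2 * \<bar>C\<bar>"
  have R: "0 < R" "2 * real (card (low_sets n d)) \<le> R" "C \<le> 2 / 5 * R"
    unfolding R_def by (auto intro!: add_pos_nonneg)
  define B where "B = poly_box n d R"
  define F where "F v x = int_poly (low_sets n d) v x / R" for v x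
  define E where "E v = {\<omega> \<in> space M. Linf_norm n (\<lambda>x. F v x - out \<omega> (transcript (q \<omega>) (F v) m) x) > \<epsilon>}" for v
  have E_sets: "E v \<in> sets M" for v unfolding E_def by (rule sets_failure[OF L])
  then have E_integrable: "integrable M (indicator (E v) :: _ \<Rightarrow> real)" for v
    by (intro integrable_real_indicator) (simp_all add: emeasure_eq_measure)
  have fB: "finite B" by (simp add: B_def)
  \<comment> \<open>The zero polynomial makes \<open>B\<close> nonempty, so that
    \<open>card B\<close> can be cancelled at the end.\<close>
  have "(\<lambda>_. 0) \<in> B" using R(1) by (simp add: B_def poly_box_def PiE_dflt_def int_poly_def)
  then have B_pos: "card B > 0" using fB by (auto simp: card_gt_0_iff)
  have many: "2 / 3 * real (card B) \<le> (\<Sum>v\<in>B. indicator (E v) \<omega>)" if \<omega>: "\<omega> \<in> space M" for \<omega>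
  proof -
    define A where "A = {v \<in> B. \<forall>x\<in>cube n. \<bar>F v x - out \<omega> (transcript (q \<omega>) (F v) m) x\<bar> \<le> \<epsilon>}"
    \<comment> \<open>Fixing \<open>\<omega>\<close> gives a deterministic learner: a measurable map
      into \<open>count_space (cube n)\<close> takes its values in \<open>cube n\<close>.\<close>
    have "q \<omega> t h \<in> cube n" if "t < m" "h \<in> space (history_space n t)" for t h
    proof -
      have "(\<lambda>(\<omega>, h). q \<omega> t h) \<in> M \<Otimes>\<^sub>M history_space n t \<rightarrow>\<^sub>M count_space (cube n)"
        using L that(1) by (simp add: rand_learner_def)
      from measurable_space[OF this, of "(\<omega>, h)"] show ?thesis
        using \<omega> that(2) by (simp add: space_pair_measure)
    qed
    then have "3 * card A \<le> card B"
      unfolding A_def B_def F_def[abs_def] by (rule card_successes_le[OF _ less \<epsilon> V R])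
    moreover have "card (B - A) = card B - card A"
      using fB by (intro card_Diff_subset) (auto simp: A_def intro: finite_subset[of _ B])
    ultimately have "2 / 3 * real (card B) \<le> real (card (B - A))" by linarith
    also have "B - A = {v \<in> B. \<omega> \<in> E v}"
      using \<omega> unfolding A_def E_def not_le[symmetric] Linf_norm_le_iff by blast
    also have "real (card {v \<in> B. \<omega> \<in> E v}) = (\<Sum>v\<in>B. indicator (E v) \<omega>)"
      using fB by (simp add: indicator_def sum.If_cases Int_def)
    finally show ?thesis .
  qed
  have "2 / 3 * real (card B) = (\<integral>\<omega>. 2 / 3 * real (card B) \<partial>M)" by (simp add: prob_space)
  also have "\<dots> \<le> (\<integral>\<omega>. (\<Sum>v\<in>B. indicator (E v) \<omega>) \<partial>M)"
    using many by (intro integral_mono Bochner_Integration.integrable_sum E_integrable) auto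
  also have "\<dots> = (\<Sum>v\<in>B. measure M (E v))"
    using E_sets by (subst Bochner_Integration.integral_sum[OF E_integrable]) simp
  also have "\<dots> \<le> (\<Sum>v\<in>B. \<delta>)"
    unfolding E_def F_def using R(1)
    by (intro sum_mono fail scaled_int_poly_in_bounded_polys) (auto simp: B_def poly_box_def)
  finally have "2 / 3 * real (card B) \<le> \<delta> * real (card B)" by (simp add: mult.commute)
  then show False using B_pos \<delta> by simp
qed

section \<open>Upper bounds by interpolation\<close>

text \<open>Nodes and weights are the same for all characters, so the formula extends linearly to
  their combinations.\<close>

lemma ex_interpolation_bounded_polys:
  fixes n d :: nat
  defines "D \<equiv> card (low_sets n d)"
  shows "\<exists>p w. (\<forall>t<D. p t \<in> cube n) \<and>
    (\<forall>f\<in>bounded_polys n d. \<forall>x\<in>cube n. f x = (\<Sum>t<D. w t x * f (p t)))"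
proof -
  obtain p w where p: "\<forall>t<D. p t \<in> cube n"
    and w: "\<forall>S\<in>low_sets n d. \<forall>x\<in>cube n. chi S x = (\<Sum>t<D. w t x * chi S (p t))"
    using ex_interpolation[OF finite_low_sets cube_nonempty, of n d n chi] unfolding D_def by blast
  have "f x = (\<Sum>t<D. w t x * f (p t))" if f: "f \<in> bounded_polys n d" and x: "x \<in> cube n" for f x
  proof -
    obtain \<theta> where \<theta>: "\<And>x. x \<in> cube n \<Longrightarrow> f x = (\<Sum>S\<in>low_sets n d. \<theta> S * chi S x)"
      using f unfolding bounded_polys_def low_sets_def by blast
    have "f x = (\<Sum>S\<in>low_sets n d. \<theta> S * (\<Sum>t<D. w t x * chi S (p t)))"
      using w x by (simp add: \<theta>)
    also have "\<dots> = (\<Sum>t<D. w t x * (\<Sum>S\<in>low_sets n d. \<theta> S * chi S (p t)))"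
      by (simp add: sum_distrib_left mult_ac) (rule sum.swap)
    also have "\<dots> = (\<Sum>t<D. w t x * f (p t))" using p by (intro sum.cong) (auto simp: \<theta>)
    finally show ?thesis .
  qed
  with p show ?thesis by blast
qed

lemma transcript_nonadaptive: "t < m \<Longrightarrow> transcript (\<lambda>t _. p t) f m t = (p t, f (p t))"
proof (induction m)
  case (Suc m)
  then show ?case by (cases "t = m") (simp_all add: Let_def)
qed simp

lemma det_recovers_card:
  assumes "0 \<le> \<epsilon>"
  shows "det_recovers n (bounded_polys n d) \<epsilon> (card (low_sets n d))"
proof -
  let ?D = "card (low_sets n d)"
  obtain p w where p: "\<forall>t<?D. p t \<in> cube n"
    and w: "\<forall>f\<in>bounded_polys n d. \<forall>x\<in>cube n. f x = (\<Sum>t<?D. w t x * f (p t))"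
    using ex_interpolation_bounded_polys by blast
  show ?thesis
    unfolding det_recovers_def det_learner_def Linf_norm_le_iff
  proof (intro exI[of _ "\<lambda>t _. p t"] exI[of _ "\<lambda>h x. \<Sum>t<?D. w t x * snd (h t)"] conjI ballI)
    fix f x assume "f \<in> bounded_polys n d" "x \<in> cube n"
    then have "f x = (\<Sum>t<?D. w t x * f (p t))" using w by blast
    then show "\<bar>f x - (\<Sum>t<?D. w t x * snd (transcript (\<lambda>t _. p t) f ?D t))\<bar> \<le> \<epsilon>"
      using assms by (simp add: transcript_nonadaptive)
  qed (use p in auto)
qed

lemma rand_recovers_card:
  assumes "0 \<le> \<epsilon>" "0 \<le> \<delta>"
  shows "rand_recovers TYPE('w) n (bounded_polys n d) \<epsilon> \<delta> (card (low_sets n d))"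
proof -
  let ?D = "card (low_sets n d)"
  obtain p w where p: "\<forall>t<?D. p t \<in> cube n"
    and w: "\<forall>f\<in>bounded_polys n d. \<forall>x\<in>cube n. f x = (\<Sum>t<?D. w t x * f (p t))"
    using ex_interpolation_bounded_polys by blast
  \<comment> \<open>A point mass gives a probability space on an arbitrary type
    \<open>'w\<close>.\<close>
  define M :: "'w measure" where "M = return (count_space UNIV) undefined"
  define out where "out h x = (\<Sum>t<?D. w t x * snd (h t))" for h :: history and x
  have "rand_learner M n ?D (\<lambda>_ t _. p t) (\<lambda>_. out)"
    unfolding rand_learner_def
  proof (intro conjI allI impI ballI)
    show "prob_space M" unfolding M_def by (rule prob_space_return) simp
  next
    fix x
    have "(\<lambda>z :: 'w \<times> history. snd (snd z t)) \<in> borel_measurable (M \<Otimes>\<^sub>M history_space n ?D)"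
      if "t < ?D" for t
    proof -
      have "(\<lambda>h. h t) \<in> history_space n ?D \<rightarrow>\<^sub>M count_space (cube n) \<Otimes>\<^sub>M borel"
        unfolding history_space_def using that by (intro measurable_component_singleton) simp
      from measurable_compose[OF measurable_snd measurable_compose[OF this measurable_snd]]
      show ?thesis .
    qed
    then show "(\<lambda>(\<omega>, h). out h x) \<in> borel_measurable (M \<Otimes>\<^sub>M history_space n ?D)"
      unfolding out_def case_prod_beta' by (intro borel_measurable_sum borel_measurable_times) auto
  qed (use p in simp)
  moreover have "measure M {\<omega> \<in> space M.
      Linf_norm n (\<lambda>x. f x - out (transcript (\<lambda>t _. p t) f ?D) x) > \<epsilon>} \<le> \<delta>"
    if f: "f \<in> bounded_polys n d" for f
  proof -
    have "\<bar>f x - out (transcript (\<lambda>t _. p t) f ?D) x\<bar> \<le> \<epsilon>" if "x \<in> cube n" for x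
    proof -
      have "f x = (\<Sum>t<?D. w t x * f (p t))" using w f that by blast
      then show ?thesis using assms(1) by (simp add: out_def transcript_nonadaptive)
    qed
    then have "Linf_norm n (\<lambda>x. f x - out (transcript (\<lambda>t _. p t) f ?D) x) \<le> \<epsilon>"
      by (simp add: Linf_norm_le_iff)
    then show ?thesis using assms(2) by (simp add: not_less[symmetric])
  qed
  ultimately show ?thesis unfolding rand_recovers_def by blast
qed

theorem propositionB1:
  fixes n d D :: nat and \<epsilon> \<delta> :: real
  assumes "1 \<le> n" and "d \<le> n"
    and "D = (\<Sum>k=0..d. n choose k)"
    and "0 < \<epsilon>" "\<epsilon> < 1" and "0 < \<delta>" "\<delta> < 1"
  shows "det_complexity n (bounded_polys n d) \<epsilon> = enat D \<and>
    (0 < 2 * \<delta> + \<epsilon> \<and> 2 * \<delta> + \<epsilon> < 1 / 30 \<longrightarrow>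
       ereal (real D / 2) \<le> ereal_of_enat (rand_complexity TYPE('w) n (bounded_polys n d) \<epsilon> \<delta>) \<and>
       rand_complexity TYPE('w) n (bounded_polys n d) \<epsilon> \<delta> \<le> enat D)"
proof (intro conjI impI)
  have D: "D = card (low_sets n d)" using assms(3) by (simp add: card_low_sets)
  show "det_complexity n (bounded_polys n d) \<epsilon> = enat D"
    unfolding det_complexity_def
  proof (rule antisym)
    show "Inf (enat ` {m. det_recovers n (bounded_polys n d) \<epsilon> m}) \<le> enat D"
      unfolding D using det_recovers_card assms(4) by (intro Inf_lower) auto
    show "enat D \<le> Inf (enat ` {m. det_recovers n (bounded_polys n d) \<epsilon> m})"
      unfolding D using det_recovers_imp_card_le assms(5) by (intro Inf_greatest) auto
  qed
  show "rand_complexity TYPE('w) n (bounded_polys n d) \<epsilon> \<delta> \<le> enat D"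
    unfolding rand_complexity_def D
    using assms(4,6) by (intro Inf_lower imageI CollectI rand_recovers_card) auto
  assume "0 < 2 * \<delta> + \<epsilon> \<and> 2 * \<delta> + \<epsilon> < 1 / 30"
  then have small: "\<epsilon> < 1 / 30" "\<delta> < 2 / 3" using assms(4,6) by linarith+
  have "D \<le> 2 * m" if "rand_recovers TYPE('w) n (bounded_polys n d) \<epsilon> \<delta> m" for m
    unfolding D using that small by (rule rand_recovers_imp_card_le)
  \<comment> \<open>There are no halves in \<open>enat\<close>, so the bound is rounded up to an
    integer before passing to the infimum.\<close>
  then have "(D + 1) div 2 \<le> m" if "rand_recovers TYPE('w) n (bounded_polys n d) \<epsilon> \<delta> m" for m
    using that by fastforce
  then have "enat ((D + 1) div 2) \<le> rand_complexity TYPE('w) n (bounded_polys n d) \<epsilon> \<delta>"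
    unfolding rand_complexity_def by (intro Inf_greatest) auto
  then have "ereal_of_enat (enat ((D + 1) div 2))
      \<le> ereal_of_enat (rand_complexity TYPE('w) n (bounded_polys n d) \<epsilon> \<delta>)"
    by (simp only: ereal_of_enat_le_iff)
  moreover have "real D / 2 \<le> real ((D + 1) div 2)" by linarith
  ultimately show "ereal (real D / 2)
      \<le> ereal_of_enat (rand_complexity TYPE('w) n (bounded_polys n d) \<epsilon> \<delta>)"
    by (intro order_trans[OF _ \<open>ereal_of_enat _ \<le> _\<close>]) simp
qed

end
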